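(* Consider the semi-discrete nodal DG scheme for the one-dimensional Euler equations with gravity: for $i=1,\dots,N$, $i_1=0,\dots,k$, $$\frac{\Delta x}{2}\frac{\mathrm d\mathbf U_{i_1}^i}{\mathrm dt}+\sum_{l=0}^k2D_{i_1,l}\mathbf F^S(\mathbf U_{i_1}^i,\mathbf U_{l}^i)+\frac{\tau_{i_1}}{\omega_{i_1}}\left(\mathbf F_{i_1}^{*,i}-\mathbf F(\mathbf U_{i_1}^i)\right)=\mathbf S_{i_1}^i,\qquad \mathbf S_{i_1}^i=\left(0,\ \rho_{i_1}^i\Theta_{i_1}^i,\ m_{i_1}^i\Theta_{i_1}^i\right)^T,$$ $$\Theta_{i_1}^i=\frac{1}{\rho^{e,i}_{i_1}}\sum_{l=0}^k2D_{i_1,l}F_2^S(\mathbf U_{i_1}^{e,i},\mathbf U_l^{e,i}),$$ where all notation is as in the context, and assume that the boundary conditions are periodic, compactly supported, or reflective. Let the nodal values $\mathbf U_{i_1}^i(t)\in\mathscr G$ be a differentiable solution of this system on a time interval. Then the scheme is entropy conservative within each cell, in the sense that for every $i$ $$\frac{\mathrm d}{\mathrm dt}\left(\sum_{i_1=0}^k\frac{\Delta x}{2}\omega_{i_1}\,\mathcal U(\mathbf U_{i_1}^i)\right)=\mathcal F_0^{*,i}-\mathcal F_k^{*,i},$$ where $$\mathcal F_k^{*,i}=(\mathbf V_k^i)^T\hat{\mathbf F}(\mathbf U_k^i,\mathbf U_0^{i+1})-\psi_k^i,\qquad \mathcal F_0^{*,i}=(\mathbf V_0^i)^T\hat{\mathbf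 F}(\mathbf U_k^{i-1},\mathbf U_0^i)-\psi_0^i,$$ and it is entropy stable in the sense that $$\frac{\mathrm d}{\mathrm dt}\left(\sum_{i=1}^N\sum_{i_1=0}^k\frac{\Delta x}{2}\omega_{i_1}\,\mathcal U(\mathbf U_{i_1}^i)\right)\le0.$$
   Context: Equations: $\mathbf U_t+\mathbf F(\mathbf U)_x=\mathbf S(\mathbf U,x)$ with $\mathbf U=(\rho,m,\mathcal E)^T$, $m=\rho u$, $\mathbf F(\mathbf U)=(m,\ \rho u^2+p,\ u(\mathcal E+p))^T$, $\mathbf S=(0,-\rho\phi_x,-m\phi_x)^T$, $\phi=\phi(x)$ a given potential, $\mathcal E=\frac{p}{\gamma-1}+\frac12\rho u^2$, $\gamma=1.4$. Admissible set: $\mathscr G=\{(\rho,m,\mathcal E):\rho>0,\ p>0\}$. $\mathbf U^e:[a,b]\to\mathscr G$ is a given hydrostatic steady state: zero velocity and $p^e_x=-\rho^e\phi_x$. Entropy: $s=\ln(p\rho^{-\gamma})$, $\mathcal U(\mathbf U)=-\frac{\rho s}{\gamma-1}$, entropy variable $\mathbf V=\mathcal U'(\mathbf U)^T=\left(\frac{\gamma-s}{\gamma-1}-\frac{\rho u^2}{2p},\ \frac{\rho u}{p},\ -\frac{\rho}{p}\right)^T$, potential flux $\psi=\rho u$. Subscripts/superscripts on $\mathbf V,\psi$ indicate evaluation at the corresponding nodal state. Mesh: $[a,b]$ is divided into $N$ uniform cells $K_i=[x_{i-1/2},x_{i+1/2}]$ of size $\Delta x$ and centers $x_i$, with $x_{1/2}=a$,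 $x_{N+1/2}=b$. Let $k\ge1$, let $-1=X_0<\dots<X_k=1$ be the $k+1$ Gauss–Lobatto points on $[-1,1]$ with weights $\omega_0,\dots,\omega_k$, $L_l$ the Lagrange basis with $L_l(X_j)=\delta_{lj}$, $D_{jl}=L_l'(X_j)$, and $\tau_0=-1$, $\tau_k=1$, $\tau_j=0$ for $0<j<k$. $\mathbf U_{i_1}^i=(\rho^i_{i_1},m^i_{i_1},\mathcal E^i_{i_1})^T$ is the nodal value of the numerical solution at $x_i+\frac{\Delta x}2X_{i_1}$ in $K_i$; $\mathbf U_{i_1}^{e,i}$, $\rho_{i_1}^{e,i}$ are the values of $\mathbf U^e$, $\rho^e$ at that point. Fluxes: $\mathbf F^{*,i}_0=\hat{\mathbf F}(\mathbf U_k^{i-1},\mathbf U_0^i)$, $\mathbf F^{*,i}_k=\hat{\mathbf F}(\mathbf U_k^i,\mathbf U_0^{i+1})$, $\mathbf F^{*,i}_{i_1}=0$ for $0<i_1<k$. $\mathbf F^S=(F^S_1,F_2^S,F_3^S)^T:\mathscr G\times\mathscr G\to\mathbb R^3$ is an entropy conservative flux: consistent ($\mathbf F^S(\mathbf U,\mathbf U)=\mathbf F(\mathbf U)$), symmetric in its two arguments, and $(\mathbf V_R-\mathbf V_L)^T\mathbf F^S(\mathbf U_L,\mathbf U_R)=\psi_R-\psi_L$. $\hat{\mathbf F}$ is the Lax–Friedrichs flux $\hat{\mathbf F}(\mathbf U_L,\mathbf U_R)=\frac12(\mathbf F(\mathbf U_L)+\mathbf F(\mathbf U_R))-\frac{\alpha}{2}(\mathbf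 U_R-\mathbf U_L)$ with a scalar $\alpha=\alpha(\mathbf U_L,\mathbf U_R)\ge\max\{|u_L|+c_L,|u_R|+c_R\}$, $c=\sqrt{\gamma p/\rho}$, chosen such that $\hat{\mathbf F}$ is entropy stable: $(\mathbf V_R-\mathbf V_L)^T\hat{\mathbf F}(\mathbf U_L,\mathbf U_R)\le\psi_R-\psi_L$ for all $\mathbf U_L,\mathbf U_R\in\mathscr G$. Boundary conditions fix the exterior states $\mathbf U_k^0$, $\mathbf U_0^{N+1}$: periodic means $\mathbf U_k^0=\mathbf U_k^N$, $\mathbf U_0^{N+1}=\mathbf U_0^1$; reflective means $\mathbf U_k^0=(\rho_0^1,-m_0^1,\mathcal E_0^1)^T$ and $\mathbf U_0^{N+1}=(\rho_k^N,-m_k^N,\mathcal E_k^N)^T$; compactly supported means that the motion does not reach the boundary: $\mathbf U_k^0=\mathbf U_0^1$, $\mathbf U_0^{N+1}=\mathbf U_k^N$, and these states have zero velocity. *)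

theory Defs
  imports "HOL-Analysis.Analysis" "HOL-Computational_Algebra.Polynomial"
begin

section \<open>Euler equations: states, flux, entropy\<close>

text \<open>A state is \<open>U = (\<rho>, m, \<E>)\<close>, stored as a vector in \<open>real ^ 3\<close>.\<close>

definition gam :: real where
  "gam = 1.4"

definition density :: "real ^ 3 \<Rightarrow> real" where
  "density U = U $ 1"

definition momentum :: "real ^ 3 \<Rightarrow> real" where
  "momentum U = U $ 2"

definition energy :: "real ^ 3 \<Rightarrow> real" where
  "energy U = U $ 3"

definition velocity :: "real ^ 3 \<Rightarrow> real" where
  "velocity U = momentum U / density U"

text \<open>The equation of state \<open>\<E> = p / (\<gamma> - 1) + \<rho> u\<^sup>2 / 2\<close>, solved for \<open>p\<close>.\<close>

definition pressure :: "real ^ 3 \<Rightarrow> real" where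
  "pressure U = (gam - 1) * (energy U - density U * (velocity U)\<^sup>2 / 2)"

definition admissible :: "(real ^ 3) set" where
  "admissible = {U. density U > 0 \<and> pressure U > 0}"

definition sound_speed :: "real ^ 3 \<Rightarrow> real" where
  "sound_speed U = sqrt (gam * pressure U / density U)"

definition euler_flux :: "real ^ 3 \<Rightarrow> real ^ 3" where
  "euler_flux U = vector
     [momentum U,
      density U * (velocity U)\<^sup>2 + pressure U,
      velocity U * (energy U + pressure U)]"

definition specific_entropy :: "real ^ 3 \<Rightarrow> real" where
  "specific_entropy U = ln (pressure U * density U powr (- gam))"

definition entropy :: "real ^ 3 \<Rightarrow> real" where
  "entropy U = - (density U * specific_entropy U / (gam - 1))"

definition entropy_var :: "real ^ 3 \<Rightarrow> real ^ 3" where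
  "entropy_var U = vector
     [(gam - specific_entropy U) / (gam - 1) - density U * (velocity U)\<^sup>2 / (2 * pressure U),
      density U * velocity U / pressure U,
      - (density U / pressure U)]"

definition potential_flux :: "real ^ 3 \<Rightarrow> real" where
  "potential_flux U = density U * velocity U"

definition hydrostatic_state :: "real \<Rightarrow> real \<Rightarrow> (real \<Rightarrow> real) \<Rightarrow> (real \<Rightarrow> real ^ 3) \<Rightarrow> bool" where
  "hydrostatic_state a b \<phi> Ue \<longleftrightarrow>
     (\<forall>x\<in>{a..b}. Ue x \<in> admissible \<and> velocity (Ue x) = 0 \<and>
        (\<exists>\<phi>x. (\<phi> has_real_derivative \<phi>x) (at x within {a..b}) \<and>
              ((\<lambda>y. pressure (Ue y)) has_real_derivative - (density (Ue x) * \<phi>x))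
                (at x within {a..b})))"


section \<open>Two-point fluxes\<close>

definition entropy_conservative_flux :: "(real ^ 3 \<Rightarrow> real ^ 3 \<Rightarrow> real ^ 3) \<Rightarrow> bool" where
  "entropy_conservative_flux FS \<longleftrightarrow>
     (\<forall>U\<in>admissible. FS U U = euler_flux U) \<and>
     (\<forall>UL\<in>admissible. \<forall>UR\<in>admissible. FS UL UR = FS UR UL) \<and>
     (\<forall>UL\<in>admissible. \<forall>UR\<in>admissible.
        (entropy_var UR - entropy_var UL) \<bullet> FS UL UR = potential_flux UR - potential_flux UL)"

definition entropy_stable_flux :: "(real ^ 3 \<Rightarrow> real ^ 3 \<Rightarrow> real ^ 3) \<Rightarrow> bool" where
  "entropy_stable_flux Fhat \<longleftrightarrow>
     (\<forall>UL\<in>admissible. \<forall>UR\<in>admissible.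
        (entropy_var UR - entropy_var UL) \<bullet> Fhat UL UR \<le> potential_flux UR - potential_flux UL)"

definition lax_friedrichs ::
  "(real ^ 3 \<Rightarrow> real ^ 3 \<Rightarrow> real) \<Rightarrow> real ^ 3 \<Rightarrow> real ^ 3 \<Rightarrow> real ^ 3" where
  "lax_friedrichs \<alpha> UL UR =
     (1 / 2) *\<^sub>R (euler_flux UL + euler_flux UR) - (\<alpha> UL UR / 2) *\<^sub>R (UR - UL)"


section \<open>Gauss--Lobatto quadrature on \<open>[-1, 1]\<close>\<close>

text \<open>Rodrigues' formula.\<close>

definition legendre_poly :: "nat \<Rightarrow> real poly" where
  "legendre_poly n = smult (1 / (2 ^ n * fact n)) ((pderiv ^^ n) ([:-1, 0, 1:] ^ n))"

definition lagrange_poly :: "nat \<Rightarrow> (nat \<Rightarrow> real) \<Rightarrow> nat \<Rightarrow> real poly" where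
  "lagrange_poly k X l = (\<Prod>j\<in>{..k} - {l}. smult (1 / (X l - X j)) [:- X j, 1:])"

text \<open>
  The \<open>k + 1\<close> Gauss--Lobatto nodes are \<open>-1\<close>, \<open>1\<close> and the \<open>k - 1\<close> roots of the derivative of the
  \<open>k\<close>-th Legendre polynomial; the weights are those of the interpolatory rule on these nodes.
  Only the values at indices \<open>0, \<dots>, k\<close> matter.
\<close>

definition gauss_lobatto :: "nat \<Rightarrow> (nat \<Rightarrow> real) \<Rightarrow> (nat \<Rightarrow> real) \<Rightarrow> bool" where
  "gauss_lobatto k X \<omega> \<longleftrightarrow>
     X 0 = -1 \<and> X k = 1 \<and> strict_mono_on {0..k} X \<and>
     (\<forall>j. 0 < j \<and> j < k \<longrightarrow> poly (pderiv (legendre_poly k)) (X j) = 0) \<and>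
     (\<forall>l\<le>k. \<omega> l = integral {-1..1} (poly (lagrange_poly k X l)))"

definition diff_matrix :: "nat \<Rightarrow> (nat \<Rightarrow> real) \<Rightarrow> nat \<Rightarrow> nat \<Rightarrow> real" where
  "diff_matrix k X j l = poly (pderiv (lagrange_poly k X l)) (X j)"

definition bdry_sign :: "nat \<Rightarrow> nat \<Rightarrow> real" where
  "bdry_sign k j = (if j = 0 then -1 else if j = k then 1 else 0)"


section \<open>The semi-discrete nodal DG scheme\<close>

definition cell_size :: "real \<Rightarrow> real \<Rightarrow> nat \<Rightarrow> real" where
  "cell_size a b N = (b - a) / real N"

text \<open>Cells are numbered \<open>1, \<dots>, N\<close>, and cell \<open>i\<close> has center \<open>a + (i - 1/2) \<Delta>x\<close>.\<close>

definition mesh_node :: "real \<Rightarrow> real \<Rightarrow> nat \<Rightarrow> (nat \<Rightarrow> real) \<Rightarrow> nat \<Rightarrow> nat \<Rightarrow> real" where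
  "mesh_node a b N X i j =
     a + (real i - 1 / 2) * cell_size a b N + cell_size a b N / 2 * X j"

text \<open>
  Grid functions \<open>W i j\<close> are the nodal values at node \<open>j\<close> of cell \<open>i\<close>. The exterior states are
  \<open>W 0 k\<close> and \<open>W (N + 1) 0\<close>; no other values in the ghost cells \<open>0\<close> and \<open>N + 1\<close> are used.
\<close>

definition interface_flux ::
  "(real ^ 3 \<Rightarrow> real ^ 3 \<Rightarrow> real ^ 3) \<Rightarrow> nat \<Rightarrow> (nat \<Rightarrow> nat \<Rightarrow> real ^ 3) \<Rightarrow> nat \<Rightarrow> nat \<Rightarrow> real ^ 3" where
  "interface_flux Fhat k W i j =
     (if j = 0 then Fhat (W (i - 1) k) (W i 0)
      else if j = k then Fhat (W i k) (W (i + 1) 0)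
      else 0)"

definition source_coeff ::
  "(real ^ 3 \<Rightarrow> real ^ 3 \<Rightarrow> real ^ 3) \<Rightarrow> nat \<Rightarrow> (nat \<Rightarrow> real) \<Rightarrow> (nat \<Rightarrow> nat \<Rightarrow> real ^ 3)
     \<Rightarrow> nat \<Rightarrow> nat \<Rightarrow> real" where
  "source_coeff FS k X We i j =
     1 / density (We i j) * (\<Sum>l=0..k. 2 * diff_matrix k X j l * FS (We i j) (We i l) $ 2)"

definition source_term ::
  "(real ^ 3 \<Rightarrow> real ^ 3 \<Rightarrow> real ^ 3) \<Rightarrow> nat \<Rightarrow> (nat \<Rightarrow> real) \<Rightarrow> (nat \<Rightarrow> nat \<Rightarrow> real ^ 3)
     \<Rightarrow> (nat \<Rightarrow> nat \<Rightarrow> real ^ 3) \<Rightarrow> nat \<Rightarrow> nat \<Rightarrow> real ^ 3" where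
  "source_term FS k X We W i j = vector
     [0,
      density (W i j) * source_coeff FS k X We i j,
      momentum (W i j) * source_coeff FS k X We i j]"

definition reflect :: "real ^ 3 \<Rightarrow> real ^ 3" where
  "reflect U = vector [density U, - momentum U, energy U]"

definition periodic_bc :: "nat \<Rightarrow> nat \<Rightarrow> (nat \<Rightarrow> nat \<Rightarrow> real ^ 3) \<Rightarrow> bool" where
  "periodic_bc N k W \<longleftrightarrow> W 0 k = W N k \<and> W (N + 1) 0 = W 1 0"

definition reflective_bc :: "nat \<Rightarrow> nat \<Rightarrow> (nat \<Rightarrow> nat \<Rightarrow> real ^ 3) \<Rightarrow> bool" where
  "reflective_bc N k W \<longleftrightarrow> W 0 k = reflect (W 1 0) \<and> W (N + 1) 0 = reflect (W N k)"

definition compact_support_bc :: "nat \<Rightarrow> nat \<Rightarrow> (nat \<Rightarrow> nat \<Rightarrow> real ^ 3) \<Rightarrow> bool" where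
  "compact_support_bc N k W \<longleftrightarrow>
     W 0 k = W 1 0 \<and> W (N + 1) 0 = W N k \<and> velocity (W 1 0) = 0 \<and> velocity (W N k) = 0"

end

theory Submission
  imports Defs
begin

text \<open>
  Gauss--Lobatto quadrature with \<open>k + 1\<close> nodes is exact up to degree \<open>2 k - 1\<close>, and integrating
  \<open>(L\<^sub>j L\<^sub>l)'\<close> exactly gives summation by parts, \<open>\<omega>\<^sub>j D\<^sub>j\<^sub>l + \<omega>\<^sub>l D\<^sub>l\<^sub>j = \<delta>\<^sub>j\<^sub>l \<tau>\<^sub>j\<close>. Pairing the scheme with
  \<open>\<omega>\<^sub>j V\<^sub>j\<close>, the source drops out because \<open>V \<bullet> (0, \<rho> \<Theta>, m \<Theta>) = 0\<close> for every \<open>\<Theta>\<close>, and the symmetry and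
  entropy conservation of the two-point flux collapse the volume terms to boundary terms.
  Summed over the cells, every interior interface contributes a nonpositive amount by entropy
  stability. At a reflective wall the flux between a state and its mirror image has only a
  momentum component, so entropy stability of that pair gives the sign.
\<close>

section \<open>Gauss--Lobatto quadrature and summation by parts\<close>

definition poly_integral :: "real \<Rightarrow> real \<Rightarrow> real poly \<Rightarrow> real" where
  "poly_integral a b p = integral {a..b} (poly p)"

lemma integrable_poly: "poly (p :: real poly) integrable_on {a..b}"
  by (intro integrable_continuous_real continuous_intros)

lemma poly_integral_0 [simp]: "poly_integral a b 0 = 0"
  by (simp add: poly_integral_def poly_0[abs_def])

lemma poly_integral_add: "poly_integral a b (p + q) = poly_integral a b p + poly_integral a b q"
proof -
  have "poly (p + q) = (\<lambda>x. poly p x + poly q x)" by auto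
  then show ?thesis by (simp add: poly_integral_def integral_add integrable_poly)
qed

lemma poly_integral_smult: "poly_integral a b (smult c p) = c * poly_integral a b p"
proof -
  have "poly (smult c p) = (\<lambda>x. c * poly p x)" by auto
  then show ?thesis by (simp add: poly_integral_def)
qed

lemma poly_integral_sum: "poly_integral a b (\<Sum>i\<in>A. f i) = (\<Sum>i\<in>A. poly_integral a b (f i))"
  by (induction A rule: infinite_finite_induct) (simp_all add: poly_integral_add)

lemma poly_integral_pderiv:
  assumes "a \<le> b"
  shows "poly_integral a b (pderiv p) = poly p b - poly p a"
  unfolding poly_integral_def
proof (rule integral_unique, rule fundamental_theorem_of_calculus[OF assms])
  show "(poly p has_vector_derivative poly (pderiv p) x) (at x within {a..b})" for x
    using has_field_derivative_at_within[OF poly_DERIV[of p x]]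
    by (simp add: has_real_derivative_iff_has_vector_derivative)
qed

lemma poly_integral_by_parts:
  assumes "a \<le> b"
  shows "poly_integral a b (p * pderiv q) =
    poly p b * poly q b - poly p a * poly q a - poly_integral a b (pderiv p * q)"
proof -
  have "poly_integral a b (pderiv (p * q)) =
      poly_integral a b (p * pderiv q) + poly_integral a b (pderiv p * q)"
    by (simp add: pderiv_mult poly_integral_add mult.commute)
  then show ?thesis
    using poly_integral_pderiv[OF assms, of "p * q"] by simp
qed

section \<open>Orthogonality of the Legendre polynomials\<close>

text \<open>Each differentiation removes at most one factor \<open>h\<close>. With \<open>h\<close>
  = x^2 - 1 this makes the boundary terms vanish when Rodrigues' formula is integrated by
  parts.\<close>

lemma power_dvd_higher_pderiv:
  fixes h p :: "real poly"
  shows "h ^ (m + n) dvd p \<Longrightarrow> h ^ m dvd (pderiv ^^ n) p"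
proof (induction n arbitrary: m)
  case (Suc n)
  from Suc.prems have "h ^ Suc m dvd (pderiv ^^ n) p"
    using Suc.IH[of "Suc m"] by simp
  then obtain r where r: "(pderiv ^^ n) p = h ^ Suc m * r" by (elim dvdE)
  have "(pderiv ^^ Suc n) p =
      h ^ m * (h * pderiv r + smult (of_nat (Suc m)) (r * pderiv h))"
    by (simp only: funpow.simps comp_apply r pderiv_mult pderiv_power_Suc)
      (simp add: algebra_simps)
  then show ?case by simp
qed simp

text \<open>Integration by parts moves the \<open>n\<close> derivatives one by one onto
  \<open>q\<close>, whose degree is too small to survive them. The exponent \<open>k\<close> is kept
  apart from \<open>n\<close> so that it stays fixed during the induction.\<close>

lemma rodrigues_orthogonal:
  fixes q :: "real poly"
  assumes "n \<le> k" "degree q < n"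
  shows "poly_integral (-1) 1 (q * (pderiv ^^ n) ([:-1, 0, 1:] ^ k)) = 0"
  using assms
proof (induction n arbitrary: q)
  case (Suc n)
  let ?w = "[:-1, 0, 1 :: real:]"
  \<comment> \<open>Here n < k, so at least one factor x^2 - 1 outlives \<open>n\<close>
    differentiations.\<close>
  have "?w ^ 1 dvd (pderiv ^^ n) (?w ^ k)"
    using Suc.prems by (intro power_dvd_higher_pderiv le_imp_power_dvd) simp
  then obtain r where r: "(pderiv ^^ n) (?w ^ k) = ?w * r" by (auto elim: dvdE)
  have bdry: "poly ((pderiv ^^ n) (?w ^ k)) x = 0" if "x = 1 \<or> x = -1" for x
    unfolding r using that by auto
  have "poly_integral (-1) 1 (pderiv q * (pderiv ^^ n) (?w ^ k)) = 0"
  \<comment> \<open>Constants are separate: the zero polynomial has degree 0, so for n = 0 the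
    degree bound of the induction hypothesis would fail.\<close>
  proof (cases "degree q = 0")
    case True
    then have "pderiv q = 0" by (simp add: pderiv_eq_0_iff)
    then show ?thesis by simp
  next
    case False
    then show ?thesis using Suc.prems by (intro Suc.IH) (simp_all add: degree_pderiv)
  qed
  then show ?case by (simp add: poly_integral_by_parts bdry)
qed simp

lemma degree_legendre_poly: "degree (legendre_poly k) = k"
  by (simp add: legendre_poly_def degree_higher_pderiv degree_power_eq)

lemma legendre_poly_orthogonal:
  assumes "degree q < k"
  shows "poly_integral (-1) 1 (q * legendre_poly k) = 0"
  using rodrigues_orthogonal[of k k q] assms
  by (simp add: legendre_poly_def poly_integral_smult)

section \<open>Lagrange interpolation\<close>

lemma poly_lagrange_poly:
  assumes "inj_on X {..k}" "l \<le> k" "j \<le> k"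
  shows "poly (lagrange_poly k X l) (X j) = (if l = j then 1 else 0)"
proof (cases "l = j")
  case True
  have "X l - X i \<noteq> 0" if "i \<in> {..k} - {l}" for i
    using assms that by (auto dest: inj_onD)
  then show ?thesis using True
    by (auto simp: lagrange_poly_def poly_prod divide_simps intro!: prod.neutral)
next
  case False
  then have "j \<in> {..k} - {l}" using assms by auto
  then show ?thesis using False
    by (auto simp: lagrange_poly_def poly_prod intro!: prod_zero bexI[of _ j])
qed

lemma degree_lagrange_poly_le:
  assumes "l \<le> k"
  shows "degree (lagrange_poly k X l) \<le> k"
proof -
  have "degree (lagrange_poly k X l)
      \<le> (\<Sum>j\<in>{..k} - {l}. degree (smult (1 / (X l - X j)) [:- X j, 1:]))"
    unfolding lagrange_poly_def
    using degree_prod_sum_le[of "{..k} - {l}" "\<lambda>j. smult (1 / (X l - X j)) [:- X j, 1:]"]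
    unfolding comp_def by blast
  also have "\<dots> \<le> (\<Sum>j\<in>{..k} - {l}. 1)"
    by (intro sum_mono order.trans[OF degree_smult_le]) simp
  also have "\<dots> = k" using assms by simp
  finally show ?thesis .
qed

text \<open>Both sides have degree at most \<open>k\<close> and agree at k + 1 distinct
  points.\<close>

lemma lagrange_interpolation:
  assumes "inj_on X {..k}" "degree p \<le> k"
  shows "p = (\<Sum>l\<le>k. smult (poly p (X l)) (lagrange_poly k X l))"
proof (rule poly_eqI_degree[of "X ` {..k}"])
  show "poly p x = poly (\<Sum>l\<le>k. smult (poly p (X l)) (lagrange_poly k X l)) x"
    if "x \<in> X ` {..k}" for x
    using that assms(1) by (auto simp: poly_sum poly_lagrange_poly if_distrib cong: if_cong)
  show "degree p < card (X ` {..k})" using assms by (simp add: card_image)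
  have "degree (\<Sum>l\<le>k. smult (poly p (X l)) (lagrange_poly k X l)) \<le> k"
    by (intro degree_sum_le order.trans[OF degree_smult_le] degree_lagrange_poly_le) auto
  then show "degree (\<Sum>l\<le>k. smult (poly p (X l)) (lagrange_poly k X l)) < card (X ` {..k})"
    using assms(1) by (simp add: card_image)
qed

section \<open>Exactness of Gauss-Lobatto quadrature\<close>

lemma gauss_lobatto_inj:
  assumes "gauss_lobatto k X \<omega>"
  shows "inj_on X {..k}"
  using assms strict_mono_on_imp_inj_on[of "{0..k}" X]
  by (simp add: gauss_lobatto_def atLeast0AtMost)

text \<open>Divide \<open>p\<close> by the nodal polynomial \<open>w\<close>. The remainder has
  degree at most \<open>k\<close> and is integrated exactly by the choice of the weights; the
  multiple of \<open>w\<close> vanishes at the nodes, and its integral vanishes by Legendre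
  orthogonality.\<close>

lemma gauss_lobatto_exact:
  assumes gl: "gauss_lobatto k X \<omega>" and "k \<ge> 1" and "degree p \<le> 2 * k - 1"
  shows "(\<Sum>j\<le>k. \<omega> j * poly p (X j)) = poly_integral (-1) 1 p"
proof -
  note inj = gauss_lobatto_inj[OF gl]
  define h :: "real poly" where "h = [:-1, 0, 1:]"
  \<comment> \<open>Up to a constant factor, \<open>w\<close> is the product of all x - X_j.\<close>
  define w where "w = h * pderiv (legendre_poly k)"
  define q r where "q = p div w" and "r = p mod w"
  have P'0: "pderiv (legendre_poly k) \<noteq> 0"
    using \<open>k \<ge> 1\<close> by (simp add: pderiv_eq_0_iff degree_legendre_poly)
  have h_root: "poly h 1 = 0" "poly h (-1) = 0" by (simp_all add: h_def)
  have h0: "h \<noteq> 0" "degree h = 2" by (auto simp: h_def)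
  have w0: "w \<noteq> 0" and deg_w: "degree w = k + 1"
    using P'0 h0 \<open>k \<ge> 1\<close>
    by (auto simp: w_def degree_mult_eq degree_pderiv degree_legendre_poly)
  have p: "p = w * q + r" by (simp add: q_def r_def)
  have deg_r: "degree r \<le> k"
    using degree_mod_less[OF w0, of p] deg_w by (auto simp: r_def)
  have w_node: "poly w (X j) = 0" if "j \<le> k" for j
  proof -
    consider "j = 0" | "j = k" | "0 < j" "j < k" using \<open>j \<le> k\<close> by linarith
    then show ?thesis using gl by cases (auto simp: w_def h_def gauss_lobatto_def)
  qed
  have "poly_integral (-1) 1 (w * q) = 0"
  proof (cases "q = 0")
    case True
    then show ?thesis by simp
  next
    case False
    have deg_wq: "degree (w * q) = k + 1 + degree q"
      using w0 False deg_w by (simp add: degree_mult_eq)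
    \<comment> \<open>The remainder is of lower degree than \<open>w * q\<close>, so the bound 2k -
      1 on the degree of \<open>p\<close> passes to the quotient.\<close>
    with deg_r have "degree p = k + 1 + degree q"
      unfolding p by (subst degree_add_eq_left) auto
    with assms(3) have deg_q: "degree q + 2 \<le> k" by simp
    have "degree (pderiv (q * h)) < k"
      using deg_q h0 False by (simp add: degree_pderiv degree_mult_eq)
    then have "poly_integral (-1) 1 (pderiv (q * h) * legendre_poly k) = 0"
      by (rule legendre_poly_orthogonal)
    \<comment> \<open>In this grouping, integration by parts takes the derivative off the Legendre
      polynomial, and the factor \<open>h\<close> removes the boundary terms at -1 and 1.\<close>
    moreover have "w * q = (q * h) * pderiv (legendre_poly k)"
      by (simp add: w_def ac_simps)
    ultimately show ?thesis
      by (simp only: poly_integral_by_parts poly_mult h_root)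
  qed
  then have "poly_integral (-1) 1 p = poly_integral (-1) 1 r"
    unfolding p by (simp add: poly_integral_add)
  also have "\<dots> = poly_integral (-1) 1 (\<Sum>l\<le>k. smult (poly r (X l)) (lagrange_poly k X l))"
    using lagrange_interpolation[OF inj deg_r] by simp
  also have "\<dots> = (\<Sum>j\<le>k. \<omega> j * poly r (X j))"
    using gl by (auto simp: gauss_lobatto_def poly_integral_def[symmetric] poly_integral_sum poly_integral_smult intro!: sum.cong)
  also have "\<dots> = (\<Sum>j\<le>k. \<omega> j * poly p (X j))"
    by (intro sum.cong) (auto simp: p w_node)
  finally show ?thesis ..
qed

section \<open>Summation by parts for the differentiation matrix\<close>

text \<open>The derivative of L_j L_l has degree at most 2k - 1, just within the exactness of the
  rule. Its quadrature sum gives the left side, its integral the boundary values.\<close>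

lemma summation_by_parts:
  assumes gl: "gauss_lobatto k X \<omega>" and "k \<ge> 1" "j \<le> k" "l \<le> k"
  shows "\<omega> j * diff_matrix k X j l + \<omega> l * diff_matrix k X l j
    = (if j = l then bdry_sign k j else 0)"
proof -
  note L = poly_lagrange_poly[OF gauss_lobatto_inj[OF gl]]
  let ?p = "lagrange_poly k X j * lagrange_poly k X l"
  have X: "X 0 = -1" "X k = 1" using gl by (auto simp: gauss_lobatto_def)
  have "degree ?p \<le> 2 * k"
    using degree_mult_le[of "lagrange_poly k X j" "lagrange_poly k X l"]
      degree_lagrange_poly_le[of j k X] degree_lagrange_poly_le[of l k X] assms(3,4) by linarith
  then have "degree (pderiv ?p) \<le> 2 * k - 1" by (simp add: degree_pderiv)
  from gauss_lobatto_exact[OF gl \<open>k \<ge> 1\<close> this]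
  have "(\<Sum>i\<le>k. \<omega> i * poly (pderiv ?p) (X i)) = poly ?p (X k) - poly ?p (X 0)"
    by (simp add: poly_integral_pderiv X)
  \<comment> \<open>By the product rule and the cardinal property, only the nodes \<open>j\<close>
    and \<open>l\<close> contribute.\<close>
  moreover have "\<omega> i * poly (pderiv ?p) (X i) =
      (if i = j then \<omega> i * diff_matrix k X i l else 0) +
      (if i = l then \<omega> i * diff_matrix k X i j else 0)" if "i \<le> k" for i
    using that assms(3,4) by (simp add: pderiv_mult L diff_matrix_def algebra_simps)
  ultimately have "\<omega> j * diff_matrix k X j l + \<omega> l * diff_matrix k X l j
      = poly ?p (X k) - poly ?p (X 0)"
    using assms(3,4) by (simp add: sum.distrib)
  then show ?thesis
    using assms(2-4) by (auto simp: L bdry_sign_def)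
qed

text \<open>The Lagrange basis sums to the constant 1, whose derivative is zero.\<close>

lemma diff_matrix_row_sum:
  assumes gl: "gauss_lobatto k X \<omega>"
  shows "(\<Sum>l\<le>k. diff_matrix k X j l) = 0"
proof -
  have "(1 :: real poly) = (\<Sum>l\<le>k. lagrange_poly k X l)"
    using lagrange_interpolation[OF gauss_lobatto_inj[OF gl], of 1] by simp
  then have "(\<Sum>l\<le>k. pderiv (lagrange_poly k X l)) = pderiv 1"
    using higher_pderiv_sum[of 1 "lagrange_poly k X" "{..k}"] by simp
  then have "poly (\<Sum>l\<le>k. pderiv (lagrange_poly k X l)) (X j) = 0" by simp
  then show ?thesis by (simp add: diff_matrix_def poly_sum)
qed

text \<open>On the diagonal, summation by parts reads 2 \<omega>_j D_jj = \<tau>_j. This justifies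
  cancelling the weight in the boundary term of the scheme.\<close>

lemma gauss_lobatto_weight_nonzero:
  assumes "gauss_lobatto k X \<omega>" "k \<ge> 1" "j \<le> k" "bdry_sign k j \<noteq> 0"
  shows "\<omega> j \<noteq> 0"
  using summation_by_parts[OF assms(1-3,3)] assms(4) by auto

text \<open>Since the rows of \<open>Q\<close> sum to zero, \<psi>_j may be subtracted from V_j
  \<bullet> F_jl. The difference is symmetric in j and l by \<open>cons\<close> and
  \<open>sym\<close>, so only the symmetric part of \<open>Q\<close> acts, and \<open>sbp\<close>
  makes that diagonal.\<close>

lemma sbp_flux_difference:
  fixes V :: "nat \<Rightarrow> 'a :: real_inner" and F :: "nat \<Rightarrow> nat \<Rightarrow> 'a"
  assumes sbp: "\<And>j l. j \<le> k \<Longrightarrow> l \<le> k \<Longrightarrow> Q j l + Q l j = (if j = l then \<tau> j else 0)"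
    and rows: "\<And>j. j \<le> k \<Longrightarrow> (\<Sum>l\<le>k. Q j l) = 0"
    and sym: "\<And>j l. j \<le> k \<Longrightarrow> l \<le> k \<Longrightarrow> F j l = F l j"
    and cons: "\<And>j l. j \<le> k \<Longrightarrow> l \<le> k \<Longrightarrow> (V j - V l) \<bullet> F j l = \<psi> j - \<psi> l"
  shows "(\<Sum>j\<le>k. \<Sum>l\<le>k. 2 * Q j l * (V j \<bullet> F j l)) = (\<Sum>j\<le>k. \<tau> j * (V j \<bullet> F j j - \<psi> j))"
proof -
  let ?A = "\<lambda>j l. Q j l * (V j \<bullet> F j l - \<psi> j)"
  have anti: "?A j l + ?A l j = (if l = j then \<tau> j * (V j \<bullet> F j j - \<psi> j) else 0)"
    if "j \<le> k" "l \<le> k" for j l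
  proof -
    have "V l \<bullet> F l j - \<psi> l = V j \<bullet> F j l - \<psi> j"
      using cons[OF that] sym[OF that] by (simp add: inner_diff_left)
    then have "?A j l + ?A l j = (Q j l + Q l j) * (V j \<bullet> F j l - \<psi> j)"
      by (simp only: distrib_right)
    then show ?thesis using sbp[OF that] by auto
  qed
  have "(\<Sum>j\<le>k. \<Sum>l\<le>k. 2 * Q j l * (V j \<bullet> F j l)) = 2 * (\<Sum>j\<le>k. \<Sum>l\<le>k. ?A j l)"
  proof -
    have "(\<Sum>l\<le>k. 2 * Q j l * (V j \<bullet> F j l)) = 2 * (\<Sum>l\<le>k. ?A j l)" if "j \<le> k" for j
    proof -
      have "(\<Sum>l\<le>k. ?A j l) = (\<Sum>l\<le>k. Q j l * (V j \<bullet> F j l)) - (\<Sum>l\<le>k. Q j l) * \<psi> j"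
        by (simp add: right_diff_distrib sum_subtractf sum_distrib_right)
      then show ?thesis using rows[OF that] by (simp add: sum_distrib_left mult.assoc)
    qed
    then show ?thesis by (simp add: sum_distrib_left)
  qed
  \<comment> \<open>One of the two copies is transposed so that \<open>Q\<close> meets its
    transpose.\<close>
  also have "\<dots> = (\<Sum>j\<le>k. \<Sum>l\<le>k. ?A j l) + (\<Sum>j\<le>k. \<Sum>l\<le>k. ?A l j)"
    by (subst (2) sum.swap) simp
  also have "\<dots> = (\<Sum>j\<le>k. \<Sum>l\<le>k. if l = j then \<tau> j * (V j \<bullet> F j j - \<psi> j) else 0)"
    unfolding sum.distrib[symmetric] using anti by (intro sum.cong refl) simp
  also have "\<dots> = (\<Sum>j\<le>k. \<tau> j * (V j \<bullet> F j j - \<psi> j))" by simp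
  finally show ?thesis .
qed

section \<open>Entropy of the Euler system\<close>

lemma inner_vec3: "(x :: real ^ 3) \<bullet> y = x $ 1 * y $ 1 + x $ 2 * y $ 2 + x $ 3 * y $ 3"
  by (simp add: inner_vec_def sum_3)

text \<open>Chain rule through velocity, pressure and specific entropy; it confirms that
  \<open>entropy_var\<close> is the gradient of \<open>entropy\<close>. Derivatives are taken within
  \<open>T\<close> to cover endpoints of the time interval.\<close>

lemma entropy_has_derivative:
  assumes "(f has_vector_derivative f') (at t within T)" "f t \<in> admissible"
  shows "((\<lambda>s. entropy (f s)) has_real_derivative entropy_var (f t) \<bullet> f') (at t within T)"
proof -
  have comp: "((\<lambda>s. f s $ i) has_real_derivative f' $ i) (at t within T)" for i
    using bounded_linear.has_vector_derivative[OF bounded_linear_vec_nth assms(1)]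
    by (simp add: has_real_derivative_iff_has_vector_derivative)
  have pos: "f t $ 1 > 0" "pressure (f t) > 0"
    using assms(2) by (auto simp: admissible_def density_def)
  define u u' p' where "u = velocity (f t)" and "u' = (f' $ 2 - u * f' $ 1) / f t $ 1"
    and "p' = (gam - 1) * (f' $ 3 - u * f' $ 2 + u\<^sup>2 / 2 * f' $ 1)"
  have der_u: "((\<lambda>s. velocity (f s)) has_real_derivative u') (at t within T)"
    unfolding velocity_def momentum_def density_def u'_def u_def
    by (rule DERIV_cong[OF DERIV_divide[OF comp comp]])
      (use pos in \<open>simp_all add: field_simps\<close>)
  have "((\<lambda>s. pressure (f s)) has_real_derivative
      (gam - 1) * (f' $ 3 - (f' $ 1 * u\<^sup>2 + 2 * (u * u') * f t $ 1) / 2)) (at t within T)"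
    unfolding pressure_def energy_def density_def u_def
    by (auto intro!: derivative_eq_intros comp der_u)
  moreover have "(gam - 1) * (f' $ 3 - (f' $ 1 * u\<^sup>2 + 2 * (u * u') * f t $ 1) / 2) = p'"
    using pos by (simp add: u'_def p'_def field_simps power2_eq_square)
  ultimately have der_p: "((\<lambda>s. pressure (f s)) has_real_derivative p') (at t within T)" by simp
  \<comment> \<open>The logarithmic derivative of p \<rho>^(-\<gamma>).\<close>
  define s' where "s' = p' / pressure (f t) - gam * f' $ 1 / f t $ 1"
  have "((\<lambda>s. f s $ 1 powr - gam) has_real_derivative
      - gam * f t $ 1 powr (- gam - 1) * f' $ 1) (at t within T)"
    by (rule DERIV_chain2[OF has_real_derivative_powr[OF pos(1)] comp])
  note der_arg = DERIV_mult[OF der_p this]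
  have "pressure (f t) * f t $ 1 powr - gam > 0" using pos by simp
  from DERIV_chain2[OF DERIV_ln[OF this] der_arg] have "((\<lambda>s. specific_entropy (f s)) has_real_derivative
      inverse (pressure (f t) * f t $ 1 powr - gam) * (p' * f t $ 1 powr - gam +
        - gam * f t $ 1 powr (- gam - 1) * f' $ 1 * pressure (f t))) (at t within T)"
    unfolding specific_entropy_def density_def .
  moreover have "inverse (pressure (f t) * f t $ 1 powr - gam) * (p' * f t $ 1 powr - gam +
      - gam * f t $ 1 powr (- gam - 1) * f' $ 1 * pressure (f t)) = s'"
    using pos by (simp add: s'_def powr_diff field_simps)
  ultimately have der_s: "((\<lambda>s. specific_entropy (f s)) has_real_derivative s') (at t within T)"
    by simp
  have "((\<lambda>s. entropy (f s)) has_real_derivative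
      - ((f' $ 1 * specific_entropy (f t) + s' * f t $ 1) / (gam - 1))) (at t within T)"
    unfolding entropy_def density_def
    by (intro DERIV_minus DERIV_cdivide DERIV_mult comp der_s)
  \<comment> \<open>Inserting \<open>p'\<close> and collecting the coefficients of the three
    components of \<open>f'\<close> gives those of \<open>entropy_var\<close>.\<close>
  moreover have "- ((f' $ 1 * specific_entropy (f t) + s' * f t $ 1) / (gam - 1))
      = entropy_var (f t) \<bullet> f'"
    using pos
    by (simp add: inner_vec3 entropy_var_def density_def gam_def s'_def p'_def u_def field_simps)
  ultimately show ?thesis by simp
qed

text \<open>The momentum part (\<rho> u / p) \<rho> \<Theta> and the energy part -(\<rho> / p) m
  \<Theta> cancel because m = \<rho> u, whatever the value of \<Theta>.\<close>

lemma entropy_var_source: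
  assumes "density (W i j) > 0"
  shows "entropy_var (W i j) \<bullet> source_term FS k X We W i j = 0"
  using assms by (simp add: inner_vec3 entropy_var_def source_term_def velocity_def)

section \<open>Boundary states: reflecting walls and fluid at rest\<close>

lemma reflect_admissible: "U \<in> admissible \<Longrightarrow> reflect U \<in> admissible"
  by (simp add: admissible_def reflect_def density_def pressure_def velocity_def momentum_def energy_def)

text \<open>Mirroring flips the sign of V_2 and \<psi> and keeps V_1 and V_3. The mass and energy
  fluxes cancel, so entropy stability of the pair is twice the claimed inequality.\<close>

lemma lax_friedrichs_wall:
  assumes "entropy_stable_flux (lax_friedrichs \<alpha>)" "U \<in> admissible"
  shows "entropy_var U \<bullet> lax_friedrichs \<alpha> (reflect U) U \<le> potential_flux U"
    and "potential_flux U \<le> entropy_var U \<bullet> lax_friedrichs \<alpha> U (reflect U)"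
proof -
  have mirror: "density (reflect U) = density U" "momentum (reflect U) = - momentum U"
      "energy (reflect U) = energy U" "velocity (reflect U) = - velocity U"
      "pressure (reflect U) = pressure U" "specific_entropy (reflect U) = specific_entropy U"
    by (simp_all add: reflect_def density_def momentum_def energy_def velocity_def pressure_def
        specific_entropy_def)
  have comps: "reflect U $ 1 = U $ 1" "reflect U $ 3 = U $ 3"
    by (simp_all add: reflect_def density_def energy_def)
  have "(entropy_var U - entropy_var (reflect U)) \<bullet> lax_friedrichs \<alpha> (reflect U) U
      \<le> potential_flux U - potential_flux (reflect U)"
    "(entropy_var (reflect U) - entropy_var U) \<bullet> lax_friedrichs \<alpha> U (reflect U)
      \<le> potential_flux (reflect U) - potential_flux U"
    using assms reflect_admissible[OF assms(2)] unfolding entropy_stable_flux_def by blast+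
  then show "entropy_var U \<bullet> lax_friedrichs \<alpha> (reflect U) U \<le> potential_flux U"
    and "potential_flux U \<le> entropy_var U \<bullet> lax_friedrichs \<alpha> U (reflect U)"
    by (simp_all add: inner_vec3 lax_friedrichs_def entropy_var_def euler_flux_def
        potential_flux_def mirror comps)
qed

text \<open>Both sides are zero: only the momentum flux remains, and V_2 = 0.\<close>

lemma lax_friedrichs_at_rest:
  assumes "velocity U = 0" "U \<in> admissible"
  shows "entropy_var U \<bullet> lax_friedrichs \<alpha> U U = potential_flux U"
  using assms
  by (simp add: inner_vec3 lax_friedrichs_def entropy_var_def euler_flux_def potential_flux_def
      velocity_def admissible_def)

section \<open>Entropy balance of the scheme\<close>

text \<open>A purely algebraic form at a fixed time: \<open>W'\<close> stands for the time
  derivative and \<open>h\<close> for half the cell size.\<close>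

lemma cell_entropy_balance:
  fixes W W' :: "nat \<Rightarrow> nat \<Rightarrow> real ^ 3"
  assumes gl: "gauss_lobatto k X \<omega>" and k: "k \<ge> 1"
    and ec: "entropy_conservative_flux FS"
    and adm: "\<And>j. j \<le> k \<Longrightarrow> W i j \<in> admissible"
    and scheme: "\<And>j. j \<le> k \<Longrightarrow>
      h *\<^sub>R W' i j + (\<Sum>l=0..k. (2 * diff_matrix k X j l) *\<^sub>R FS (W i j) (W i l))
      + (bdry_sign k j / \<omega> j) *\<^sub>R (interface_flux Fhat k W i j - euler_flux (W i j))
      = source_term FS k X We W i j"
  shows "(\<Sum>j=0..k. h * \<omega> j * (entropy_var (W i j) \<bullet> W' i j)) =
    (entropy_var (W i 0) \<bullet> Fhat (W (i - 1) k) (W i 0) - potential_flux (W i 0))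
    - (entropy_var (W i k) \<bullet> Fhat (W i k) (W (i + 1) 0) - potential_flux (W i k))"
proof -
  let ?V = "\<lambda>j. entropy_var (W i j)" and ?F = "\<lambda>j l. FS (W i j) (W i l)"
  let ?\<psi> = "\<lambda>j. potential_flux (W i j)" and ?\<tau> = "bdry_sign k" and ?D = "diff_matrix k X"
  let ?G = "interface_flux Fhat k W i"
  have node: "h * \<omega> j * (?V j \<bullet> W' i j) =
      - (\<Sum>l\<le>k. 2 * (\<omega> j * ?D j l) * (?V j \<bullet> ?F j l)) - ?\<tau> j * (?V j \<bullet> ?G j - ?V j \<bullet> ?F j j)"
    if j: "j \<le> k" for j
  proof -
    have "density (W i j) > 0" using adm[OF j] by (simp add: admissible_def)
    then have "?V j \<bullet> source_term FS k X We W i j = 0" by (rule entropy_var_source)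
    moreover have FF: "?F j j = euler_flux (W i j)"
      using ec adm[OF j] by (simp add: entropy_conservative_flux_def)
    moreover note arg_cong[OF scheme[OF j], of "\<lambda>z. \<omega> j * (?V j \<bullet> z)"]
    \<comment> \<open>With x / 0 = 0, this makes \<omega>_j (\<tau>_j / \<omega>_j) = \<tau>_j hold
      at every node.\<close>
    moreover have "?\<tau> j = 0" if "\<omega> j = 0"
      using gauss_lobatto_weight_nonzero[OF gl k j] that by auto
    ultimately have "\<omega> j * (h * (?V j \<bullet> W' i j)) + \<omega> j * (\<Sum>l\<le>k. 2 * ?D j l * (?V j \<bullet> ?F j l))
        + ?\<tau> j * (?V j \<bullet> ?G j - ?V j \<bullet> ?F j j) = 0"
      by (simp add: inner_add_right inner_sum_right inner_diff_right distrib_left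
          atLeast0AtMost mult.assoc[symmetric] split: if_splits)
    then show ?thesis by (simp add: sum_distrib_left mult.assoc mult.left_commute)
  qed
  \<comment> \<open>The summation-by-parts matrix is \<open>Q j l\<close> = \<omega>_j D_jl.\<close>
  have "(\<Sum>j\<le>k. \<Sum>l\<le>k. 2 * (\<omega> j * ?D j l) * (?V j \<bullet> ?F j l)) = (\<Sum>j\<le>k. ?\<tau> j * (?V j \<bullet> ?F j j - ?\<psi> j))"
  proof (rule sbp_flux_difference)
    show "(\<Sum>l\<le>k. \<omega> j * ?D j l) = 0" for j
      using diff_matrix_row_sum[OF gl, of j] by (simp add: sum_distrib_left[symmetric])
    show "?F j l = ?F l j" if "j \<le> k" "l \<le> k" for j l
      using ec adm that by (simp add: entropy_conservative_flux_def)
    show "(?V j - ?V l) \<bullet> ?F j l = ?\<psi> j - ?\<psi> l" if "j \<le> k" "l \<le> k" for j l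
      using ec adm that unfolding entropy_conservative_flux_def by metis
  qed (rule summation_by_parts[OF gl k])
  \<comment> \<open>By consistency \<open>?F j j\<close> is the physical flux, and its two
    occurrences cancel.\<close>
  then have "(\<Sum>j\<le>k. h * \<omega> j * (?V j \<bullet> W' i j)) = (\<Sum>j\<le>k. ?\<tau> j * (?\<psi> j - ?V j \<bullet> ?G j))"
    by (simp add: node sum_subtractf sum_negf right_diff_distrib)
  also have "\<dots> = (\<Sum>j\<le>k. (if j = k then ?\<psi> k - ?V k \<bullet> ?G k else 0)
      - (if j = 0 then ?\<psi> 0 - ?V 0 \<bullet> ?G 0 else 0))"
    using k by (intro sum.cong) (auto simp: bdry_sign_def)
  also have "\<dots> = (?\<psi> k - ?V k \<bullet> ?G k) - (?\<psi> 0 - ?V 0 \<bullet> ?G 0)"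
    by (simp add: sum_subtractf)
  finally show ?thesis using k by (simp add: interface_flux_def atLeast0AtMost)
qed

text \<open>Regroup by interfaces: entropy stability bounds what enters a cell on its left by what
  leaves the cell before it. Only the two outer fluxes remain for the boundary conditions.\<close>

lemma interface_sum_nonpos:
  fixes W :: "nat \<Rightarrow> nat \<Rightarrow> real ^ 3"
  assumes N: "N \<ge> 1"
    and es: "entropy_stable_flux (lax_friedrichs \<alpha>)"
    and adm: "\<And>i j. i \<in> {1..N} \<Longrightarrow> j \<le> k \<Longrightarrow> W i j \<in> admissible"
    and bc: "periodic_bc N k W \<or> compact_support_bc N k W \<or> reflective_bc N k W"
  shows "(\<Sum>i=1..N.
      (entropy_var (W i 0) \<bullet> lax_friedrichs \<alpha> (W (i - 1) k) (W i 0) - potential_flux (W i 0))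
      - (entropy_var (W i k) \<bullet> lax_friedrichs \<alpha> (W i k) (W (i + 1) 0) - potential_flux (W i k))) \<le> 0"
proof -
  let ?F = "lax_friedrichs \<alpha>"
  define l where "l i = entropy_var (W i 0) \<bullet> ?F (W (i - 1) k) (W i 0) - potential_flux (W i 0)" for i
  define r where "r i = entropy_var (W i k) \<bullet> ?F (W i k) (W (i + 1) 0) - potential_flux (W i k)" for i
  have stable: "entropy_var B \<bullet> ?F A B - potential_flux B \<le> entropy_var A \<bullet> ?F A B - potential_flux A"
    if "A \<in> admissible" "B \<in> admissible" for A B
    using es that by (fastforce simp: entropy_stable_flux_def inner_diff_left)
  have telescope: "(\<Sum>i=1..n. l i - r i) \<le> l 1 - r n" if "1 \<le> n" "n \<le> N" for n
    using that
  proof (induction n rule: dec_induct)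
    case (step n)
    have "l (Suc n) \<le> r n"
      using stable[of "W n k" "W (Suc n) 0"] adm[of n k] adm[of "Suc n" 0] step
      by (simp add: l_def r_def)
    then show ?case using step by simp
  qed simp
  \<comment> \<open>Periodicity makes the two ends one more interior interface; for compact support
    both terms are zero; at walls each has the right sign.\<close>
  have "l 1 \<le> r N"
    using bc
  proof (elim disjE)
    assume "periodic_bc N k W"
    then show ?thesis using stable[of "W N k" "W 1 0"] adm N
      by (simp add: l_def r_def periodic_bc_def)
  next
    assume "compact_support_bc N k W"
    then show ?thesis using N adm
      by (simp add: l_def r_def compact_support_bc_def lax_friedrichs_at_rest)
  next
    assume bc: "reflective_bc N k W"
    then have "l 1 \<le> 0" "r N \<ge> 0"
      using lax_friedrichs_wall[OF es] N adm by (auto simp: l_def r_def reflective_bc_def)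
    then show ?thesis by linarith
  qed
  with telescope[of N] N show ?thesis by (simp add: l_def r_def)
qed

theorem theorem3p2:
  fixes a b :: real and N k :: nat
    and X \<omega> :: "nat \<Rightarrow> real"
    and \<phi> :: "real \<Rightarrow> real" and Ue :: "real \<Rightarrow> real ^ 3"
    and FS :: "real ^ 3 \<Rightarrow> real ^ 3 \<Rightarrow> real ^ 3"
    and \<alpha> :: "real ^ 3 \<Rightarrow> real ^ 3 \<Rightarrow> real"
    and T :: "real set"
    and U U' :: "real \<Rightarrow> nat \<Rightarrow> nat \<Rightarrow> real ^ 3"
  defines "\<Delta>x \<equiv> cell_size a b N"
    and "Fhat \<equiv> lax_friedrichs \<alpha>"
    and "We \<equiv> (\<lambda>i j. Ue (mesh_node a b N X i j))"
  assumes "a < b" and "N \<ge> 1" and "k \<ge> 1"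
    and "gauss_lobatto k X \<omega>"
    and "hydrostatic_state a b \<phi> Ue"
    and "entropy_conservative_flux FS"
    and "\<forall>UL\<in>admissible. \<forall>UR\<in>admissible.
           \<alpha> UL UR \<ge> max (\<bar>velocity UL\<bar> + sound_speed UL) (\<bar>velocity UR\<bar> + sound_speed UR)"
    and "entropy_stable_flux Fhat"
    and "is_interval T" and "interior T \<noteq> {}"
    and "(\<forall>t\<in>T. periodic_bc N k (U t)) \<or>
         (\<forall>t\<in>T. compact_support_bc N k (U t)) \<or>
         (\<forall>t\<in>T. reflective_bc N k (U t))"
    and "\<forall>t\<in>T. \<forall>i\<in>{1..N}. \<forall>j\<in>{0..k}. U t i j \<in> admissible"
    and "\<forall>t\<in>T. \<forall>i\<in>{1..N}. \<forall>j\<in>{0..k}.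
           ((\<lambda>s. U s i j) has_vector_derivative U' t i j) (at t within T)"
    and "\<forall>t\<in>T. \<forall>i\<in>{1..N}. \<forall>j\<in>{0..k}.
           (\<Delta>x / 2) *\<^sub>R U' t i j
           + (\<Sum>l=0..k. (2 * diff_matrix k X j l) *\<^sub>R FS (U t i j) (U t i l))
           + (bdry_sign k j / \<omega> j) *\<^sub>R (interface_flux Fhat k (U t) i j - euler_flux (U t i j))
           = source_term FS k X We (U t) i j"
  shows "(\<forall>t\<in>T. \<forall>i\<in>{1..N}.
            ((\<lambda>s. \<Sum>j=0..k. \<Delta>x / 2 * \<omega> j * entropy (U s i j)) has_real_derivative
               ((entropy_var (U t i 0) \<bullet> Fhat (U t (i - 1) k) (U t i 0)
                   - potential_flux (U t i 0))
                - (entropy_var (U t i k) \<bullet> Fhat (U t i k) (U t (i + 1) 0)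
                   - potential_flux (U t i k))))
              (at t within T))
       \<and> (\<forall>t\<in>T. \<exists>d\<le>0.
            ((\<lambda>s. \<Sum>i=1..N. \<Sum>j=0..k. \<Delta>x / 2 * \<omega> j * entropy (U s i j))
               has_real_derivative d) (at t within T))"
proof -
  note gl = \<open>gauss_lobatto k X \<omega>\<close>
  let ?d = "\<lambda>t i. (entropy_var (U t i 0) \<bullet> Fhat (U t (i - 1) k) (U t i 0) - potential_flux (U t i 0))
    - (entropy_var (U t i k) \<bullet> Fhat (U t i k) (U t (i + 1) 0) - potential_flux (U t i k))"
  let ?E = "\<lambda>i s. \<Sum>j=0..k. \<Delta>x / 2 * \<omega> j * entropy (U s i j)"
  note adm = \<open>\<forall>t\<in>T. \<forall>i\<in>{1..N}. \<forall>j\<in>{0..k}. U t i j \<in> admissible\<close>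
  note deriv = \<open>\<forall>t\<in>T. \<forall>i\<in>{1..N}. \<forall>j\<in>{0..k}.
    ((\<lambda>s. U s i j) has_vector_derivative U' t i j) (at t within T)\<close>
  note scheme = \<open>\<forall>t\<in>T. \<forall>i\<in>{1..N}. \<forall>j\<in>{0..k}.
    (\<Delta>x / 2) *\<^sub>R U' t i j
    + (\<Sum>l=0..k. (2 * diff_matrix k X j l) *\<^sub>R FS (U t i j) (U t i l))
    + (bdry_sign k j / \<omega> j) *\<^sub>R (interface_flux Fhat k (U t) i j - euler_flux (U t i j))
    = source_term FS k X We (U t) i j\<close>
  have cell: "(?E i has_real_derivative ?d t i) (at t within T)" if t: "t \<in> T" and i: "i \<in> {1..N}" for t i
  proof -
    have "(?E i has_real_derivative (\<Sum>j=0..k. \<Delta>x / 2 * \<omega> j * (entropy_var (U t i j) \<bullet> U' t i j)))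
        (at t within T)"
      using deriv adm t i by (intro DERIV_sum DERIV_cmult entropy_has_derivative) auto
    \<comment> \<open>The cell balance at time \<open>t\<close>, with \<open>h\<close> = \<Delta>x /
      2.\<close>
    also have "(\<Sum>j=0..k. \<Delta>x / 2 * \<omega> j * (entropy_var (U t i j) \<bullet> U' t i j)) = ?d t i"
      using adm scheme t i
      by (intro cell_entropy_balance[OF gl \<open>k \<ge> 1\<close> \<open>entropy_conservative_flux FS\<close>]) auto
    finally show ?thesis .
  qed
  moreover have "\<exists>d\<le>0. ((\<lambda>s. \<Sum>i=1..N. ?E i s) has_real_derivative d) (at t within T)" if t: "t \<in> T" for t
  proof (intro exI conjI)
    show "((\<lambda>s. \<Sum>i=1..N. ?E i s) has_real_derivative (\<Sum>i=1..N. ?d t i)) (at t within T)"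
      using cell[OF t] by (intro DERIV_sum)
    show "(\<Sum>i=1..N. ?d t i) \<le> 0"
      using assms t unfolding Fhat_def by (intro interface_sum_nonpos) auto
  qed
  ultimately show ?thesis by blast
qed

end
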